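(* Let $\mathbf F^{[\nu]}\in\mathcal C^2$ be Lipschitz continuous for $\nu=1,\dots,N$ and let $\mathbf A,\mathbf b,\mathbf c$ describe an explicit $s$-stage Runge--Kutta method of order at least $1$. The corresponding MPRK scheme (see context) is of order at least $1$ if and only if $$\sigma_\mu=y^n_\mu+\mathcal O(h),\quad \mu=1,\dots,N.$$
   Context: All $\mathcal O$-statements are with respect to $h\to0$. MPRK scheme: applied to a production-destruction system $y_m'=\sum_{\nu=1}^N(p_{m\nu}(\mathbf y)-d_{m\nu}(\mathbf y))$, $m=1,\dots,N$, with $p_{m\nu}=d_{\nu m}$, $p_{mm}=d_{mm}=0$, and $p_{m\nu},d_{m\nu}\ge 0$ (for positive arguments), starting from a positive vector $\mathbf y^n\in\mathbb R^N$, it reads $$y^{(i)}_m=y^n_m+h\sum_{j=1}^{i-1}a_{ij}\sum_{\nu=1}^N\Big(p_{m\nu}(\mathbf y^{(j)})\frac{y^{(i)}_\nu}{\rho_{i\nu}}-d_{m\nu}(\mathbf y^{(j)})\frac{y^{(i)}_m}{\rho_{im}}\Big),\ i=1,\dots,s,\qquad y^{n+1}_m=y^n_m+h\sum_{j=1}^{s}b_{j}\sum_{\nu=1}^N\Big(p_{m\nu}(\mathbf y^{(j)})\frac{y^{n+1}_\nu}{\sigma_{\nu}}-d_{m\nu}(\mathbf y^{(j)})\frac{y^{n+1}_m}{\sigma_{m}}\Big),$$ $m=1,\dots,N$, with $a_{ij},b_j\ge0$ and $c_i=\sum_j a_{ij}$. The Patankar-weight denominators $\rho_{i\nu}=\rho_{i\nu}(\mathbf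 y^n,\mathbf y^{(1)},\dots,\mathbf y^{(i-1)})$ ($i\ge2$) and $\sigma_\nu=\sigma_\nu(\mathbf y^n,\mathbf y^{(1)},\dots,\mathbf y^{(s)})$ are continuous functions of their arguments and positive for all $h\ge0$. $\mathbf F^{[\nu]}$ has components $F^{[\nu]}_m=p_{m\nu}$ for $\nu\neq m$ and $F^{[m]}_m=-\sum_{j}d_{mj}$, so the system is $\mathbf y'=\mathbf F(\mathbf y)=\sum_{\nu=1}^N\mathbf F^{[\nu]}(\mathbf y)$. Order at least $p$: whenever $\mathbf y^n=\mathbf y(t_n)$ for a (positive) solution, $\mathbf y^{n+1}=\mathbf y(t_n+h)+\mathcal O(h^{p+1})$; as usual, order statements refer to the whole class of right-hand sides with the stated regularity, the elementary differentials belonging to different colored rooted trees being regarded as linearly independent. *)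

theory Defs
  imports "HOL-Analysis.Analysis" "HOL-Library.Landau_Symbols"
begin

(* Continuous differentiability of order k; intended for open S only, since the derivative is
   the one at interior points. *)
primrec Ck_on :: "nat \<Rightarrow> ('a::euclidean_space \<Rightarrow> 'b::euclidean_space) \<Rightarrow> 'a set \<Rightarrow> bool" where
  "Ck_on 0 f S \<longleftrightarrow> continuous_on S f"
| "Ck_on (Suc k) f S \<longleftrightarrow> (\<forall>x\<in>S. f differentiable (at x)) \<and>
     (\<forall>v. Ck_on k (\<lambda>x. frechet_derivative f (at x) v) S)"

definition ivp_solution ::
  "(real \<Rightarrow> 'a \<Rightarrow> 'a) \<Rightarrow> 'a set \<Rightarrow> real \<Rightarrow> 'a \<Rightarrow> real \<Rightarrow> (real \<Rightarrow> 'a::real_normed_vector) \<Rightarrow> bool" where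
  "ivp_solution f S t\<^sub>n y\<^sub>n T u \<longleftrightarrow> 0 < T \<and> u t\<^sub>n = y\<^sub>n \<and>
     (\<forall>t\<in>{t\<^sub>n..t\<^sub>n + T}. u t \<in> S \<and>
        (u has_vector_derivative f t (u t)) (at t within {t\<^sub>n..t\<^sub>n + T}))"

(* Stage families are functions Y on nat of which only Y 1, ..., Y s matter. *)

definition rk_step ::
  "nat \<Rightarrow> (nat \<Rightarrow> nat \<Rightarrow> real) \<Rightarrow> (nat \<Rightarrow> real) \<Rightarrow> (nat \<Rightarrow> real) \<Rightarrow>
   (real \<Rightarrow> 'a \<Rightarrow> 'a) \<Rightarrow> real \<Rightarrow> real \<Rightarrow> 'a \<Rightarrow> (nat \<Rightarrow> 'a) \<Rightarrow> 'a::real_vector \<Rightarrow> bool" where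
  "rk_step s a b c f t\<^sub>n h y\<^sub>n Y z \<longleftrightarrow>
     (\<forall>i\<in>{1..s}. Y i = y\<^sub>n + h *\<^sub>R (\<Sum>j\<in>{1..s}. a i j *\<^sub>R f (t\<^sub>n + c j * h) (Y j))) \<and>
     z = y\<^sub>n + h *\<^sub>R (\<Sum>j\<in>{1..s}. b j *\<^sub>R f (t\<^sub>n + c j * h) (Y j))"

definition rk_order_ge ::
  "'n::finite itself \<Rightarrow> nat \<Rightarrow> nat \<Rightarrow> (nat \<Rightarrow> nat \<Rightarrow> real) \<Rightarrow> (nat \<Rightarrow> real) \<Rightarrow> (nat \<Rightarrow> real) \<Rightarrow> bool" where
  "rk_order_ge _ r s a b c \<longleftrightarrow>
     (\<forall>(f :: real \<Rightarrow> real^'n \<Rightarrow> real^'n) t\<^sub>n y\<^sub>n T u Y z.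
        Ck_on (Suc r) (\<lambda>(t, y). f t y) UNIV \<longrightarrow>
        ivp_solution f UNIV t\<^sub>n y\<^sub>n T u \<longrightarrow>
        (\<forall>\<^sub>F h in at_right 0. rk_step s a b c f t\<^sub>n h y\<^sub>n (Y h) (z h)) \<longrightarrow>
        (\<lambda>h. norm (z h - u (t\<^sub>n + h))) \<in> O[at_right 0](\<lambda>h. h ^ Suc r))"

definition pos_vecs :: "(real^'n) set" where
  "pos_vecs = {y. \<forall>m. 0 < y $ m}"

definition pds ::
  "('n \<Rightarrow> 'n \<Rightarrow> real^'n \<Rightarrow> real) \<Rightarrow> ('n \<Rightarrow> 'n \<Rightarrow> real^'n \<Rightarrow> real) \<Rightarrow> bool" where
  "pds p d \<longleftrightarrow> (\<forall>y\<in>pos_vecs. \<forall>m \<nu>.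
     p m \<nu> y = d \<nu> m y \<and> p m m y = 0 \<and> d m m y = 0 \<and> 0 \<le> p m \<nu> y \<and> 0 \<le> d m \<nu> y)"

definition F_part ::
  "('n::finite \<Rightarrow> 'n \<Rightarrow> real^'n \<Rightarrow> real) \<Rightarrow> ('n \<Rightarrow> 'n \<Rightarrow> real^'n \<Rightarrow> real) \<Rightarrow> 'n \<Rightarrow> real^'n \<Rightarrow> real^'n" where
  "F_part p d \<nu> y = (\<chi> m. if m = \<nu> then - (\<Sum>j\<in>UNIV. d m j y) else p m \<nu> y)"

definition pds_class ::
  "nat \<Rightarrow> ('n::finite \<Rightarrow> 'n \<Rightarrow> real^'n \<Rightarrow> real) \<Rightarrow> ('n \<Rightarrow> 'n \<Rightarrow> real^'n \<Rightarrow> real) \<Rightarrow> bool" where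
  "pds_class k p d \<longleftrightarrow> pds p d \<and>
     (\<forall>\<nu>. Ck_on k (F_part p d \<nu>) pos_vecs \<and> (\<exists>L. L-lipschitz_on pos_vecs (F_part p d \<nu>)))"

(* A Patankar-weight denominator depending on y^n and the first k stages. For a function that only
   depends on finitely many stages, continuity in the product topology on nat => real^'n is
   ordinary joint continuity in those stages. *)
definition patankar_weight :: "nat \<Rightarrow> (real^'n \<Rightarrow> (nat \<Rightarrow> real^'n) \<Rightarrow> real) \<Rightarrow> bool" where
  "patankar_weight k w \<longleftrightarrow>
     (\<forall>y Y Y'. (\<forall>j\<in>{1..k}. Y j = Y' j) \<longrightarrow> w y Y = w y Y') \<and>
     continuous_on {(y, Y). y \<in> pos_vecs \<and> (\<forall>j\<in>{1..k}. Y j \<in> pos_vecs)} (\<lambda>(y, Y). w y Y) \<and>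
     (\<forall>y Y. y \<in> pos_vecs \<longrightarrow> (\<forall>j\<in>{1..k}. Y j \<in> pos_vecs) \<longrightarrow> 0 < w y Y)"

(* The defining equations of one step. They are linearly implicit with M-matrices having unit
   column sums, so for h >= 0 and positive y^n they determine Y 1, ..., Y s and z uniquely,
   and these vectors are positive. *)
definition mprk_step ::
  "nat \<Rightarrow> (nat \<Rightarrow> nat \<Rightarrow> real) \<Rightarrow> (nat \<Rightarrow> real) \<Rightarrow>
   (nat \<Rightarrow> 'n::finite \<Rightarrow> real^'n \<Rightarrow> (nat \<Rightarrow> real^'n) \<Rightarrow> real) \<Rightarrow>
   ('n \<Rightarrow> real^'n \<Rightarrow> (nat \<Rightarrow> real^'n) \<Rightarrow> real) \<Rightarrow>
   ('n \<Rightarrow> 'n \<Rightarrow> real^'n \<Rightarrow> real) \<Rightarrow> ('n \<Rightarrow> 'n \<Rightarrow> real^'n \<Rightarrow> real) \<Rightarrow>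
   real \<Rightarrow> real^'n \<Rightarrow> (nat \<Rightarrow> real^'n) \<Rightarrow> real^'n \<Rightarrow> bool" where
  "mprk_step s a b \<rho> \<sigma> p d h y\<^sub>n Y z \<longleftrightarrow>
     (\<forall>i\<in>{1..s}. \<forall>m. Y i $ m = y\<^sub>n $ m + h * (\<Sum>j\<in>{1..<i}. a i j * (\<Sum>\<nu>\<in>UNIV.
         p m \<nu> (Y j) * (Y i $ \<nu> / \<rho> i \<nu> y\<^sub>n Y) - d m \<nu> (Y j) * (Y i $ m / \<rho> i m y\<^sub>n Y)))) \<and>
     (\<forall>m. z $ m = y\<^sub>n $ m + h * (\<Sum>j\<in>{1..s}. b j * (\<Sum>\<nu>\<in>UNIV.
         p m \<nu> (Y j) * (z $ \<nu> / \<sigma> \<nu> y\<^sub>n Y) - d m \<nu> (Y j) * (z $ m / \<sigma> m y\<^sub>n Y))))"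

(* One step of an explicit additive Runge--Kutta scheme for y' = (sum over nu of G nu y). *)
definition ark_step ::
  "nat \<Rightarrow> (nat \<Rightarrow> nat \<Rightarrow> 'n::finite \<Rightarrow> real) \<Rightarrow> (nat \<Rightarrow> 'n \<Rightarrow> real) \<Rightarrow>
   ('n \<Rightarrow> real^'n \<Rightarrow> real^'n) \<Rightarrow> real \<Rightarrow> real^'n \<Rightarrow> (nat \<Rightarrow> real^'n) \<Rightarrow> real^'n \<Rightarrow> bool" where
  "ark_step s \<alpha> \<beta> G h y\<^sub>n V w \<longleftrightarrow>
     (\<forall>i\<in>{1..s}. V i = y\<^sub>n + h *\<^sub>R (\<Sum>j\<in>{1..<i}. \<Sum>\<nu>\<in>UNIV. \<alpha> i j \<nu> *\<^sub>R G \<nu> (V j))) \<and>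
     w = y\<^sub>n + h *\<^sub>R (\<Sum>j\<in>{1..s}. \<Sum>\<nu>\<in>UNIV. \<beta> j \<nu> *\<^sub>R G \<nu> (V j))"

(* With its solution-dependent coefficients
     alpha i j nu = a i j * Y i $ nu / rho i nu   and   beta j nu = b j * z $ nu / sigma nu,
   an MPRK step is an additive Runge--Kutta step for the parts F_part p d nu
   (lemma mprk_step_imp_ark_step). "Order at least r" is a statement about all right-hand sides of
   the class, with the elementary differentials treated as linearly independent: the
   coefficients arising along the scheme, as functions of h, must give a local error
   O(h^(r+1)) for every system (q, e) of the class, not only for (p, d) itself. The latter
   choice yields the local error of the MPRK scheme (lemma mprk_order_ge_local_error). For
   (p, d) alone the components of every F_part p d nu y sum to zero, hence the CARD('n) vectors
   F_part p d nu y are linearly dependent at each y, and the local error does not determine the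
   coefficients. *)
definition mprk_order_ge ::
  "nat \<Rightarrow> nat \<Rightarrow> (nat \<Rightarrow> nat \<Rightarrow> real) \<Rightarrow> (nat \<Rightarrow> real) \<Rightarrow>
   (nat \<Rightarrow> 'n::finite \<Rightarrow> real^'n \<Rightarrow> (nat \<Rightarrow> real^'n) \<Rightarrow> real) \<Rightarrow>
   ('n \<Rightarrow> real^'n \<Rightarrow> (nat \<Rightarrow> real^'n) \<Rightarrow> real) \<Rightarrow>
   ('n \<Rightarrow> 'n \<Rightarrow> real^'n \<Rightarrow> real) \<Rightarrow> ('n \<Rightarrow> 'n \<Rightarrow> real^'n \<Rightarrow> real) \<Rightarrow> bool" where
  "mprk_order_ge r s a b \<rho> \<sigma> p d \<longleftrightarrow>
     (\<forall>y\<^sub>n\<in>pos_vecs. \<forall>Y z.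
        (\<forall>\<^sub>F h in at_right 0. mprk_step s a b \<rho> \<sigma> p d h y\<^sub>n (Y h) (z h)) \<longrightarrow>
        (\<forall>q e t\<^sub>n T u V w.
           pds_class (Suc r) q e \<longrightarrow>
           ivp_solution (\<lambda>t y. \<Sum>\<nu>\<in>UNIV. F_part q e \<nu> y) pos_vecs t\<^sub>n y\<^sub>n T u \<longrightarrow>
           (\<forall>\<^sub>F h in at_right 0.
              ark_step s (\<lambda>i j \<nu>. a i j * (Y h i $ \<nu> / \<rho> i \<nu> y\<^sub>n (Y h)))
                (\<lambda>j \<nu>. b j * (z h $ \<nu> / \<sigma> \<nu> y\<^sub>n (Y h)))
                (F_part q e) h y\<^sub>n (V h) (w h)) \<longrightarrow>
           (\<lambda>h. norm (w h - u (t\<^sub>n + h))) \<in> O[at_right 0](\<lambda>h. h ^ Suc r)))"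

lemma F_part_sum:
  assumes "p m m y = 0" "d m m y = 0"
  shows "(\<Sum>\<nu>\<in>UNIV. p m \<nu> y * g \<nu> - d m \<nu> y * g m) = (\<Sum>\<nu>\<in>UNIV. g \<nu> *\<^sub>R F_part p d \<nu> y) $ m"
proof -
  have "(\<Sum>\<nu>\<in>UNIV. g \<nu> *\<^sub>R F_part p d \<nu> y) $ m =
      (\<Sum>\<nu>\<in>UNIV. p m \<nu> y * g \<nu> - (if m = \<nu> then (\<Sum>j\<in>UNIV. d m j y) * g m else 0))"
    using assms by (auto simp: F_part_def intro!: sum.cong)
  also have "\<dots> = (\<Sum>\<nu>\<in>UNIV. p m \<nu> y * g \<nu>) - (\<Sum>j\<in>UNIV. d m j y) * g m"
    by (simp add: sum_subtractf)
  finally show ?thesis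
    by (simp add: sum_subtractf sum_distrib_right)
qed

lemma mprk_step_imp_ark_step:
  assumes "pds p d" and "\<And>j. j \<in> {1..s} \<Longrightarrow> Y j \<in> pos_vecs"
    and "mprk_step s a b \<rho> \<sigma> p d h y\<^sub>n Y z"
  shows "ark_step s (\<lambda>i j \<nu>. a i j * (Y i $ \<nu> / \<rho> i \<nu> y\<^sub>n Y))
           (\<lambda>j \<nu>. b j * (z $ \<nu> / \<sigma> \<nu> y\<^sub>n Y)) (F_part p d) h y\<^sub>n Y z"
proof -
  have diag: "p m m (Y j) = 0" "d m m (Y j) = 0" if "j \<in> {1..s}" for m j
    using assms(1) assms(2)[OF that] by (auto simp: pds_def)
  have part: "(\<Sum>\<nu>\<in>UNIV. (k * g \<nu>) *\<^sub>R F_part p d \<nu> (Y j)) $ m =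
      k * (\<Sum>\<nu>\<in>UNIV. p m \<nu> (Y j) * g \<nu> - d m \<nu> (Y j) * g m)"
    if "j \<in> {1..s}" for k g m j
    unfolding F_part_sum[where p=p and d=d and y="Y j" and m=m, OF diag[OF that]]
    by (simp add: sum_distrib_left mult.assoc)
  show ?thesis
    unfolding ark_step_def vec_eq_iff
  proof (intro conjI ballI allI)
    fix i m assume i: "i \<in> {1..s}"
    have "(\<Sum>j\<in>{1..<i}. \<Sum>\<nu>\<in>UNIV. (a i j * (Y i $ \<nu> / \<rho> i \<nu> y\<^sub>n Y)) *\<^sub>R F_part p d \<nu> (Y j)) $ m =
      (\<Sum>j\<in>{1..<i}. a i j * (\<Sum>\<nu>\<in>UNIV.
         p m \<nu> (Y j) * (Y i $ \<nu> / \<rho> i \<nu> y\<^sub>n Y) - d m \<nu> (Y j) * (Y i $ m / \<rho> i m y\<^sub>n Y)))"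
      unfolding sum_component[of _ "{1..<i}"] by (intro sum.cong refl part) (use i in auto)
    then show "Y i $ m = (y\<^sub>n + h *\<^sub>R (\<Sum>j\<in>{1..<i}. \<Sum>\<nu>\<in>UNIV.
        (a i j * (Y i $ \<nu> / \<rho> i \<nu> y\<^sub>n Y)) *\<^sub>R F_part p d \<nu> (Y j))) $ m"
      using assms(3) i unfolding mprk_step_def vector_add_component vector_scaleR_component
      by (simp only: real_scaleR_def)
  next
    fix m
    have "(\<Sum>j\<in>{1..s}. \<Sum>\<nu>\<in>UNIV. (b j * (z $ \<nu> / \<sigma> \<nu> y\<^sub>n Y)) *\<^sub>R F_part p d \<nu> (Y j)) $ m =
      (\<Sum>j\<in>{1..s}. b j * (\<Sum>\<nu>\<in>UNIV.
         p m \<nu> (Y j) * (z $ \<nu> / \<sigma> \<nu> y\<^sub>n Y) - d m \<nu> (Y j) * (z $ m / \<sigma> m y\<^sub>n Y)))"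
      unfolding sum_component[of _ "{1..s}"] by (intro sum.cong refl part) auto
    then show "z $ m = (y\<^sub>n + h *\<^sub>R (\<Sum>j\<in>{1..s}. \<Sum>\<nu>\<in>UNIV.
        (b j * (z $ \<nu> / \<sigma> \<nu> y\<^sub>n Y)) *\<^sub>R F_part p d \<nu> (Y j))) $ m"
      using assms(3) unfolding mprk_step_def vector_add_component vector_scaleR_component
      by (simp only: real_scaleR_def)
  qed
qed

lemma mprk_order_ge_local_error:
  assumes "mprk_order_ge r s a b \<rho> \<sigma> p d" and "pds_class (Suc r) p d" and "y\<^sub>n \<in> pos_vecs"
    and "ivp_solution (\<lambda>t y. \<Sum>\<nu>\<in>UNIV. F_part p d \<nu> y) pos_vecs t\<^sub>n y\<^sub>n T u"
    and step: "\<forall>\<^sub>F h in at_right 0. mprk_step s a b \<rho> \<sigma> p d h y\<^sub>n (Y h) (z h)"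
    and pos: "\<forall>\<^sub>F h in at_right 0. \<forall>j\<in>{1..s}. Y h j \<in> pos_vecs"
  shows "(\<lambda>h. norm (z h - u (t\<^sub>n + h))) \<in> O[at_right 0](\<lambda>h. h ^ Suc r)"
proof -
  have "pds p d" using assms(2) by (simp add: pds_class_def)
  have "\<forall>\<^sub>F h in at_right 0.
      ark_step s (\<lambda>i j \<nu>. a i j * (Y h i $ \<nu> / \<rho> i \<nu> y\<^sub>n (Y h)))
        (\<lambda>j \<nu>. b j * (z h $ \<nu> / \<sigma> \<nu> y\<^sub>n (Y h))) (F_part p d) h y\<^sub>n (Y h) (z h)"
    using step pos by eventually_elim (rule mprk_step_imp_ark_step[OF \<open>pds p d\<close>], auto)
  then show ?thesis
    using assms(1-4) step unfolding mprk_order_ge_def by blast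
qed

end

theory Submission
  imports Defs
begin

text \<open>The Patankar equations are linear systems whose matrix has unit column sums and nonpositive
  off-diagonal entries. Their solutions are therefore positive and have the same component sum as
  \<open>y\<^sub>n\<close>, so they are bounded, and by induction every stage and the result are
  \<open>y\<^sub>n + O(h)\<close>. Consequently \<open>\<sigma> \<mu> = y\<^sub>n $ \<mu> + O(h)\<close> is equivalent
  to \<open>z $ \<mu> / \<sigma> \<mu> = 1 + O(h)\<close>. Under this condition the additive Runge--Kutta step is an
  explicit Euler step up to \<open>O(h\<^sup>2)\<close>, because the weights \<open>b\<close> sum to one. Conversely, the
  system that transports mass at unit rate from component \<open>\<mu>\<close> to another component has the
  local error \<open>h * (z $ \<mu> / \<sigma> \<mu> - 1)\<close> there.\<close>

section \<open>Landau estimates for vectors and quotients\<close>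

lemma norm_vec_bigo_iff:
  fixes X :: "'a \<Rightarrow> real^'n::finite" and g :: "'a \<Rightarrow> real"
  shows "(\<lambda>h. norm (X h)) \<in> O[F](g) \<longleftrightarrow> (\<forall>m. (\<lambda>h. X h $ m) \<in> O[F](g))"
proof
  assume X: "(\<lambda>h. norm (X h)) \<in> O[F](g)"
  show "\<forall>m. (\<lambda>h. X h $ m) \<in> O[F](g)"
  proof
    fix m
    have "(\<lambda>h. X h $ m) \<in> O[F](\<lambda>h. norm (X h))"
      by (intro bigoI[of _ 1] always_eventually allI) (simp add: component_le_norm_cart)
    then show "(\<lambda>h. X h $ m) \<in> O[F](g)"
      using X by (rule landau_o.big_trans)
  qed
next
  assume X: "\<forall>m. (\<lambda>h. X h $ m) \<in> O[F](g)"
  have "(\<lambda>h. norm (X h)) \<in> O[F](\<lambda>h. \<Sum>m\<in>UNIV. \<bar>X h $ m\<bar>)"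
    by (intro bigoI[of _ 1] always_eventually allI)
      (use norm_le_l1_cart in \<open>force intro: order_trans[OF _ abs_ge_self]\<close>)
  moreover have "(\<lambda>h. \<Sum>m\<in>UNIV. \<bar>X h $ m\<bar>) \<in> O[F](g)"
    using X by (intro big_sum_in_bigo) simp
  ultimately show "(\<lambda>h. norm (X h)) \<in> O[F](g)"
    by (rule landau_o.big_trans)
qed

lemma tendsto_imp_bigo_1:
  fixes f :: "'a \<Rightarrow> real"
  assumes "(f \<longlongrightarrow> l) F"
  shows "f \<in> O[F](\<lambda>_. 1)"
  using assms by (intro bigoI_tendsto[where c = l]) auto

lemma tendsto_of_diff_bigo_id:
  fixes f :: "real \<Rightarrow> real"
  assumes "(\<lambda>h. f h - l) \<in> O[at_right 0](\<lambda>h. h)"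
  shows "(f \<longlongrightarrow> l) (at_right 0)"
proof -
  have "(\<lambda>h::real. h) \<in> o[at_right 0](\<lambda>_. 1)"
    by (rule smalloI_tendsto) (auto intro: tendsto_ident_at)
  then have "(\<lambda>h. f h - l) \<in> o[at_right 0](\<lambda>_. 1)"
    using assms by (rule landau_o.big_small_trans[rotated])
  then have "((\<lambda>h. f h - l) \<longlongrightarrow> 0) (at_right 0)"
    by (auto dest: smalloD_tendsto)
  then show ?thesis by (simp add: LIM_zero_iff)
qed

lemma tendsto_vec_of_diff_bigo_id:
  fixes X :: "real \<Rightarrow> real^'n::finite"
  assumes "\<And>m. (\<lambda>h. X h $ m - y $ m) \<in> O[at_right 0](\<lambda>h. h)"
  shows "(X \<longlongrightarrow> y) (at_right 0)"
  by (rule vec_tendstoI) (rule tendsto_of_diff_bigo_id[OF assms])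

text \<open>Both directions rest on the identity \<open>z - y - (z / r - 1) * r = r - y\<close>. The
  nonzero limit makes \<open>r\<close> and \<open>inverse r\<close> bounded near zero, so
  multiplying or dividing by \<open>r\<close> preserves O(h).\<close>

lemma ratio_diff_one_bigo_iff:
  fixes z r :: "real \<Rightarrow> real"
  assumes "(\<lambda>h. z h - y) \<in> O[at_right 0](\<lambda>h. h)"
    and r: "(r \<longlongrightarrow> r0) (at_right 0)" "r0 \<noteq> 0"
  shows "(\<lambda>h. z h / r h - 1) \<in> O[at_right 0](\<lambda>h. h)
    \<longleftrightarrow> (\<lambda>h. r h - y) \<in> O[at_right 0](\<lambda>h. h)"
proof -
  have nz: "\<forall>\<^sub>F h in at_right 0. r h \<noteq> 0"
    using r by (rule tendsto_imp_eventually_ne)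
  show ?thesis
  proof
    assume "(\<lambda>h. z h / r h - 1) \<in> O[at_right 0](\<lambda>h. h)"
    then have "(\<lambda>h. (z h / r h - 1) * r h) \<in> O[at_right 0](\<lambda>h. h * 1)"
      by (intro landau_o.big.mult tendsto_imp_bigo_1[OF r(1)])
    then have "(\<lambda>h. (z h - y) - (z h / r h - 1) * r h) \<in> O[at_right 0](\<lambda>h. h)"
      by (intro sum_in_bigo(2) assms(1)) simp
    then show "(\<lambda>h. r h - y) \<in> O[at_right 0](\<lambda>h. h)"
      by (rule landau_o.big.in_cong[THEN iffD1, rotated])
        (use nz in eventually_elim, simp add: field_simps)
  next
    assume "(\<lambda>h. r h - y) \<in> O[at_right 0](\<lambda>h. h)"
    then have "(\<lambda>h. (z h - y) - (r h - y)) \<in> O[at_right 0](\<lambda>h. h)"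
      by (rule sum_in_bigo(2)[OF assms(1)])
    then have "(\<lambda>h. ((z h - y) - (r h - y)) * inverse (r h)) \<in> O[at_right 0](\<lambda>h. h * 1)"
      by (intro landau_o.big.mult tendsto_imp_bigo_1[OF tendsto_inverse[OF r]])
    then have "(\<lambda>h. ((z h - y) - (r h - y)) * inverse (r h)) \<in> O[at_right 0](\<lambda>h. h)"
      by simp
    then show "(\<lambda>h. z h / r h - 1) \<in> O[at_right 0](\<lambda>h. h)"
      by (rule landau_o.big.in_cong[THEN iffD1, rotated])
        (use nz in eventually_elim, simp add: field_simps)
  qed
qed

section \<open>The positive orthant and linear Patankar systems\<close>

lemma open_pos_vecs: "open (pos_vecs :: (real^'n::finite) set)"
proof -
  have "pos_vecs = (\<Inter>m. {y :: real^'n. 0 < y $ m})"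
    by (auto simp: pos_vecs_def)
  moreover have "open {y :: real^'n. 0 < y $ m}" for m
    by (intro open_Collect_less continuous_intros)
  ultimately show ?thesis by (metis (no_types, lifting) open_INT finite UNIV_I)
qed

lemma eventually_in_pos_vecs:
  assumes "(X \<longlongrightarrow> y) F" "y \<in> pos_vecs"
  shows "\<forall>\<^sub>F h in F. X h \<in> pos_vecs"
  using topological_tendstoD[OF assms(1) open_pos_vecs assms(2)] .

text \<open>Summing the equations over the indices of nonpositive entries of a putative solution gives
  a nonpositive left-hand side, but a positive right-hand side.\<close>
lemma patankar_system_pos:
  fixes P :: "'n::finite \<Rightarrow> 'n \<Rightarrow> real" and x y :: "'n \<Rightarrow> real"
  assumes eq: "\<And>m. x m = y m + h * (\<Sum>\<nu>\<in>UNIV. P m \<nu> * x \<nu> - P \<nu> m * x m)"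
    and P: "\<And>m \<nu>. 0 \<le> P m \<nu>" and y: "\<And>m. 0 < y m" and h: "0 \<le> h"
  shows "0 < x m"
proof (rule ccontr)
  assume m: "\<not> 0 < x m"
  define N where "N = {m. x m \<le> 0}"
  have "N \<noteq> {}" using m by (auto simp: N_def not_less)
  \<comment> \<open>Exchange within \<open>N\<close> cancels. Between \<open>N\<close> and its
    complement every term is nonnegative: gains come from positive entries, and losses are
    proportional to nonpositive ones.\<close>
  have "(\<Sum>m\<in>N. \<Sum>\<nu>\<in>UNIV. P m \<nu> * x \<nu> - P \<nu> m * x m) =
      (\<Sum>m\<in>N. \<Sum>\<nu>\<in>N. P m \<nu> * x \<nu> - P \<nu> m * x m) +
      (\<Sum>m\<in>N. \<Sum>\<nu>\<in>-N. P m \<nu> * x \<nu> - P \<nu> m * x m)"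
    by (simp add: sum.distrib[symmetric] sum.union_disjoint[symmetric])
  also have "(\<Sum>m\<in>N. \<Sum>\<nu>\<in>N. P m \<nu> * x \<nu> - P \<nu> m * x m) = 0"
    unfolding sum_subtractf using sum.swap[of "\<lambda>m \<nu>. P m \<nu> * x \<nu>" N N] by simp
  also have "0 + (\<Sum>m\<in>N. \<Sum>\<nu>\<in>-N. P m \<nu> * x \<nu> - P \<nu> m * x m) \<ge> 0"
  proof -
    have "P \<nu> m * x m \<le> P m \<nu> * x \<nu>" if "m \<in> N" "\<nu> \<in> -N" for m \<nu>
      by (rule order_trans[OF mult_nonneg_nonpos mult_nonneg_nonneg])
        (use that P in \<open>auto simp: N_def\<close>)
    then show ?thesis unfolding add_0 by (intro sum_nonneg) simp
  qed
  finally have "0 \<le> h * (\<Sum>m\<in>N. \<Sum>\<nu>\<in>UNIV. P m \<nu> * x \<nu> - P \<nu> m * x m)"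
    using h by simp
  moreover have "(\<Sum>m\<in>N. x m) =
      (\<Sum>m\<in>N. y m) + h * (\<Sum>m\<in>N. \<Sum>\<nu>\<in>UNIV. P m \<nu> * x \<nu> - P \<nu> m * x m)"
    unfolding sum_distrib_left sum.distrib[symmetric]
    by (intro sum.cong refl) (rule eq[unfolded sum_distrib_left])
  moreover have "(\<Sum>m\<in>N. x m) \<le> 0" by (rule sum_nonpos) (simp add: N_def)
  moreover have "0 < (\<Sum>m\<in>N. y m)" using \<open>N \<noteq> {}\<close> y by (intro sum_pos) auto
  ultimately show False by linarith
qed

text \<open>Conservation of mass: each exchange term occurs once as a gain and once as a loss, so
  the double sum cancels after swapping the order of summation.\<close>

lemma patankar_system_sum:
  fixes P :: "'n::finite \<Rightarrow> 'n \<Rightarrow> real" and x y :: "'n \<Rightarrow> real"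
  assumes "\<And>m. x m = y m + h * (\<Sum>\<nu>\<in>UNIV. P m \<nu> * x \<nu> - P \<nu> m * x m)"
  shows "(\<Sum>m\<in>UNIV. x m) = (\<Sum>m\<in>UNIV. y m)"
proof -
  have "(\<Sum>m\<in>UNIV. x m) =
      (\<Sum>m\<in>UNIV. y m + h * (\<Sum>\<nu>\<in>UNIV. P m \<nu> * x \<nu> - P \<nu> m * x m))"
    by (intro sum.cong refl assms)
  also have "\<dots> = (\<Sum>m\<in>UNIV. y m) +
      h * (\<Sum>m\<in>UNIV. \<Sum>\<nu>\<in>UNIV. P m \<nu> * x \<nu> - P \<nu> m * x m)"
    by (simp add: sum.distrib sum_distrib_left)
  also have "(\<Sum>m\<in>UNIV. \<Sum>\<nu>\<in>UNIV. P m \<nu> * x \<nu> - P \<nu> m * x m) = 0"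
    unfolding sum_subtractf using sum.swap[of "\<lambda>m \<nu>. P m \<nu> * x \<nu>" UNIV UNIV] by simp
  finally show ?thesis by simp
qed

text \<open>Positivity and conservation bound every entry of \<open>x h\<close> by the total of
  \<open>y\<close>, uniformly in \<open>h\<close> and without inverting the system matrix. The
  increment is then \<open>h\<close> times a bounded sum.\<close>

lemma patankar_system_bigo:
  fixes P :: "real \<Rightarrow> 'n::finite \<Rightarrow> 'n \<Rightarrow> real" and x :: "real \<Rightarrow> 'n \<Rightarrow> real"
  assumes eq: "\<forall>\<^sub>F h in at_right 0. \<forall>m.
      x h m = y m + h * (\<Sum>\<nu>\<in>UNIV. P h m \<nu> * x h \<nu> - P h \<nu> m * x h m)"
    and P: "\<forall>\<^sub>F h in at_right 0. \<forall>m \<nu>. 0 \<le> P h m \<nu>"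
    and lim: "\<And>m \<nu>. ((\<lambda>h. P h m \<nu>) \<longlongrightarrow> P0 m \<nu>) (at_right 0)"
    and y: "\<And>m. 0 < y m"
  shows "(\<lambda>h. x h m - y m) \<in> O[at_right 0](\<lambda>h. h)"
proof -
  have "\<forall>\<^sub>F h in at_right 0. \<forall>m. norm (x h m) \<le> (\<Sum>m\<in>UNIV. y m) * norm (1::real)"
    using eq P eventually_at_right_less[of 0]
  proof eventually_elim
    case (elim h)
    have pos: "0 < x h m" for m
      by (rule patankar_system_pos[where P = "P h" and y = y and h = h]) (use elim y in auto)
    have "x h m \<le> (\<Sum>m\<in>UNIV. x h m)" for m
      using pos by (intro member_le_sum) (auto intro: less_imp_le)
    also have "(\<Sum>m\<in>UNIV. x h m) = (\<Sum>m\<in>UNIV. y m)"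
      by (rule patankar_system_sum[where P = "P h" and h = h]) (use elim in auto)
    finally show ?case using pos by (simp add: less_imp_le)
  qed
  then have x: "(\<lambda>h. x h m) \<in> O[at_right 0](\<lambda>_. 1)" for m
    by (intro bigoI) (auto elim: eventually_mono)
  have "(\<lambda>h. P h m \<nu> * x h \<nu>') \<in> O[at_right 0](\<lambda>_. 1 * 1)" for m \<nu> \<nu>'
    by (intro landau_o.big.mult tendsto_imp_bigo_1[OF lim] x)
  then have "(\<lambda>h. \<Sum>\<nu>\<in>UNIV. P h m \<nu> * x h \<nu> - P h \<nu> m * x h m) \<in> O[at_right 0](\<lambda>_. 1)"
    by (intro big_sum_in_bigo sum_in_bigo) simp_all
  then have "(\<lambda>h. h * (\<Sum>\<nu>\<in>UNIV. P h m \<nu> * x h \<nu> - P h \<nu> m * x h m))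
      \<in> O[at_right 0](\<lambda>h. h * 1)"
    by (intro landau_o.big.mult) auto
  then have "(\<lambda>h. h * (\<Sum>\<nu>\<in>UNIV. P h m \<nu> * x h \<nu> - P h \<nu> m * x h m)) \<in> O[at_right 0](\<lambda>h. h)"
    by simp
  then show ?thesis
    by (rule landau_o.big.in_cong[THEN iffD1, rotated])
      (use eq in eventually_elim, metis add_diff_cancel_left')
qed

section \<open>Convergence of the Patankar weights, the MPRK stages and the result\<close>

lemma F_part_continuous_on:
  assumes "Ck_on (Suc k) (F_part p d \<nu>) pos_vecs"
  shows "continuous_on pos_vecs (F_part p d \<nu>)"
  using assms
  by (auto intro!: continuous_at_imp_continuous_on differentiable_imp_continuous_within)

text \<open>Regularity is stated for the parts. Off the diagonal a production rate is a component of
  a part; on the diagonal it vanishes on \<open>pos_vecs\<close>.\<close>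

lemma production_continuous_on:
  assumes "pds p d" "continuous_on pos_vecs (F_part p d \<nu>)"
  shows "continuous_on pos_vecs (p m \<nu>)"
proof (cases "m = \<nu>")
  case True
  have "continuous_on pos_vecs (p m \<nu>) \<longleftrightarrow> continuous_on (pos_vecs :: (real^'a) set) (\<lambda>_. 0::real)"
    using True assms(1) by (intro continuous_on_cong) (auto simp: pds_def)
  then show ?thesis by simp
next
  case False
  have "continuous_on pos_vecs (\<lambda>y. F_part p d \<nu> y $ m)"
    by (intro continuous_intros assms)
  then show ?thesis using False by (simp add: F_part_def)
qed

lemma patankar_weight_pos:
  assumes "patankar_weight k w" "y \<in> pos_vecs"
  shows "0 < w y (\<lambda>_. y)"
  using assms by (auto simp: patankar_weight_def)

lemma patankar_weight_tendsto:
  fixes Y :: "'b \<Rightarrow> nat \<Rightarrow> real^'n::finite"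
  assumes w: "patankar_weight k w" and y: "y \<in> pos_vecs"
    and lim: "\<And>j. j \<in> {1..k} \<Longrightarrow> ((\<lambda>h. Y h j) \<longlongrightarrow> y) F"
  shows "((\<lambda>h. w y (Y h)) \<longlongrightarrow> w y (\<lambda>_. y)) F"
proof -
  \<comment> \<open>Nothing is known about stages beyond index \<open>k\<close>. Freezing them at
    \<open>y\<close> gives a family that converges in the product topology, and the value of
    \<open>w\<close> does not change.\<close>
  define Y' where "Y' = (\<lambda>h j. if j \<in> {1..k} then Y h j else y)"
  have lim': "((\<lambda>h. Y' h j) \<longlongrightarrow> y) F" for j
    using lim[of j] by (cases "j \<in> {1..k}") (auto simp: Y'_def)
  have "limitin (product_topology (\<lambda>_. euclidean) UNIV) Y' (\<lambda>_. y) F"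
    using lim' by (simp add: limitin_componentwise)
  then have Y': "(Y' \<longlongrightarrow> (\<lambda>_. y)) F"
    by (simp add: euclidean_product_topology)
  have "\<forall>\<^sub>F h in F. \<forall>j\<in>{1..k}. Y' h j \<in> pos_vecs"
    by (intro eventually_ball_finite ballI eventually_in_pos_vecs[OF lim' y]) simp
  then have ev: "\<forall>\<^sub>F h in F.
      (y, Y' h) \<in> {(y, Y). y \<in> pos_vecs \<and> (\<forall>j\<in>{1..k}. Y j \<in> pos_vecs)}"
    by eventually_elim (use y in auto)
  have "((\<lambda>h. case (y, Y' h) of (y, Y) \<Rightarrow> w y Y) \<longlongrightarrow> (case (y, \<lambda>_. y) of (y, Y) \<Rightarrow> w y Y)) F"
    by (rule continuous_on_tendsto_compose[OF _ tendsto_Pair[OF tendsto_const Y'] _ ev])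
      (use w y in \<open>auto simp: patankar_weight_def\<close>)
  moreover have "w y (Y' h) = w y (Y h)" for h
    using w by (auto simp: patankar_weight_def Y'_def)
  ultimately show ?thesis by simp
qed

text \<open>Serves both the stages and the final update, with \<open>J\<close> the set of stages
  summed over. The guard \<open>J \<noteq> {}\<close> covers the first stage, whose sum is empty and
  whose denominators are subject to no assumption.\<close>

lemma patankar_stage_bigo:
  fixes X :: "real \<Rightarrow> real^'n::finite" and Y :: "real \<Rightarrow> nat \<Rightarrow> real^'n"
  assumes pds: "pds p d" and cont: "\<And>\<nu>. continuous_on pos_vecs (F_part p d \<nu>)"
    and y: "y \<in> pos_vecs" and J: "finite J" and k: "\<And>j. j \<in> J \<Longrightarrow> 0 \<le> k j"
    and Y: "\<And>j. j \<in> J \<Longrightarrow> ((\<lambda>h. Y h j) \<longlongrightarrow> y) (at_right 0)"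
    and r: "\<And>\<nu>. J \<noteq> {} \<Longrightarrow> ((\<lambda>h. r h \<nu>) \<longlongrightarrow> R \<nu>) (at_right 0)"
    and R: "\<And>\<nu>. J \<noteq> {} \<Longrightarrow> 0 < R \<nu>"
    and eq: "\<forall>\<^sub>F h in at_right 0. \<forall>m. X h $ m = y $ m + h * (\<Sum>j\<in>J. k j * (\<Sum>\<nu>\<in>UNIV.
         p m \<nu> (Y h j) * (X h $ \<nu> / r h \<nu>) - d m \<nu> (Y h j) * (X h $ m / r h m)))"
  shows "(\<lambda>h. X h $ m - y $ m) \<in> O[at_right 0](\<lambda>h. h)"
proof (cases "J = {}")
  case True
  have "\<forall>\<^sub>F h in at_right 0. X h $ m - y $ m = 0"
    using eq by eventually_elim (simp add: True)
  then show ?thesis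
    by (intro bigoI[of _ 0]) (auto elim: eventually_mono)
next
  case False
  \<comment> \<open>All stage contributions merge into one exchange matrix that absorbs the
    denominators. Since \<open>d m \<nu>\<close> equals \<open>p \<nu> m\<close> on positive
    vectors, the destruction terms become its transpose, which is the form treated by
    \<open>patankar_system_bigo\<close>.\<close>
  define P where "P = (\<lambda>h m \<nu>. \<Sum>j\<in>J. k j * (p m \<nu> (Y h j) / r h \<nu>))"
  have Ypos: "\<forall>\<^sub>F h in at_right 0. \<forall>j\<in>J. Y h j \<in> pos_vecs"
    by (intro eventually_ball_finite ballI eventually_in_pos_vecs[OF Y y] J)
  have "\<forall>\<^sub>F h in at_right 0. \<forall>\<nu>. 0 < r h \<nu>"
    by (intro eventually_all_finite order_tendstoD(1)[OF r R] False)
  then have nonneg: "\<forall>\<^sub>F h in at_right 0. \<forall>m \<nu>. 0 \<le> P h m \<nu>"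
    using Ypos
  proof eventually_elim
    case (elim h)
    have "0 \<le> p m \<nu> (Y h j)" if "j \<in> J" for m \<nu> j
      using pds elim(2) that by (auto simp: pds_def)
    then show ?case
      unfolding P_def using elim(1) k
      by (auto intro!: sum_nonneg mult_nonneg_nonneg divide_nonneg_pos)
  qed
  have lim: "((\<lambda>h. P h m \<nu>) \<longlongrightarrow> (\<Sum>j\<in>J. k j * (p m \<nu> y / R \<nu>))) (at_right 0)" for m \<nu>
    unfolding P_def
  proof (intro tendsto_sum tendsto_mult tendsto_const tendsto_divide r False)
    fix j assume j: "j \<in> J"
    show "((\<lambda>h. p m \<nu> (Y h j)) \<longlongrightarrow> p m \<nu> y) (at_right 0)"
      by (rule continuous_on_tendsto_compose[OF production_continuous_on[OF pds cont] Y[OF j] y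
            eventually_in_pos_vecs[OF Y[OF j] y]])
  qed (use R[OF False, of \<nu>] in simp)
  have "\<forall>\<^sub>F h in at_right 0. \<forall>m. X h $ m =
      y $ m + h * (\<Sum>\<nu>\<in>UNIV. P h m \<nu> * X h $ \<nu> - P h \<nu> m * X h $ m)"
    using eq Ypos
  proof eventually_elim
    case (elim h)
    show ?case
    proof
      fix m
      have dp: "d m \<nu> (Y h j) = p \<nu> m (Y h j)" if "j \<in> J" for j \<nu>
        using pds elim(2) that by (simp add: pds_def)
      have "(\<Sum>j\<in>J. k j * (\<Sum>\<nu>\<in>UNIV.
            p m \<nu> (Y h j) * (X h $ \<nu> / r h \<nu>) - d m \<nu> (Y h j) * (X h $ m / r h m))) =
          (\<Sum>j\<in>J. \<Sum>\<nu>\<in>UNIV. k j * (p m \<nu> (Y h j) / r h \<nu>) * X h $ \<nu> -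
            k j * (p \<nu> m (Y h j) / r h m) * X h $ m)"
        unfolding sum_distrib_left by (intro sum.cong refl) (simp add: dp algebra_simps)
      also have "\<dots> = (\<Sum>\<nu>\<in>UNIV. P h m \<nu> * X h $ \<nu> - P h \<nu> m * X h $ m)"
        unfolding P_def by (subst sum.swap) (simp add: sum_subtractf sum_distrib_right)
      finally show "X h $ m = y $ m + h * (\<Sum>\<nu>\<in>UNIV. P h m \<nu> * X h $ \<nu> - P h \<nu> m * X h $ m)"
        using elim(1)[THEN spec, of m] by (simp only:)
    qed
  qed
  from patankar_system_bigo[OF this nonneg lim] y show ?thesis
    by (simp add: pos_vecs_def)
qed

text \<open>Strong induction over the stages: the denominators of stage \<open>i\<close> depend only
  on earlier stages, so they already converge to their positive values at the constant family
  \<open>y\<close>, and \<open>patankar_stage_bigo\<close> applies. The final update follows in the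
  same way once all stages converge.\<close>

lemma mprk_step_asymptotics:
  fixes Y :: "real \<Rightarrow> nat \<Rightarrow> real^'n::finite"
  assumes pds: "pds p d" and cont: "\<And>\<nu>. continuous_on pos_vecs (F_part p d \<nu>)"
    and a: "\<And>i j. i \<in> {1..s} \<Longrightarrow> j \<in> {1..s} \<Longrightarrow> 0 \<le> a i j"
    and b: "\<And>j. j \<in> {1..s} \<Longrightarrow> 0 \<le> b j"
    and \<rho>: "\<And>i \<nu>. i \<in> {2..s} \<Longrightarrow> patankar_weight (i - 1) (\<rho> i \<nu>)"
    and \<sigma>: "\<And>\<nu>. patankar_weight s (\<sigma> \<nu>)"
    and y: "y \<in> pos_vecs"
    and step: "\<forall>\<^sub>F h in at_right 0. mprk_step s a b \<rho> \<sigma> p d h y (Y h) (z h)"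
  shows mprk_stage_tendsto: "i \<in> {1..s} \<Longrightarrow> ((\<lambda>h. Y h i) \<longlongrightarrow> y) (at_right 0)"
    and mprk_result_bigo: "(\<lambda>h. z h $ m - y $ m) \<in> O[at_right 0](\<lambda>h. h)"
proof -
  show Y: "((\<lambda>h. Y h i) \<longlongrightarrow> y) (at_right 0)" if "i \<in> {1..s}" for i
    using that
  proof (induction i rule: less_induct)
    case (less i)
    have IH: "((\<lambda>h. Y h j) \<longlongrightarrow> y) (at_right 0)" if "j \<in> {1..<i}" for j
      using less that by auto
    \<comment> \<open>A nonempty range of earlier stages forces \<open>2 \<le> i\<close>, which is
      where the assumption on \<open>\<rho>\<close> is available.\<close>
    have i: "i \<in> {2..s}" if "{1..<i} \<noteq> {}"
      using that less.prems by auto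
    have "\<forall>\<^sub>F h in at_right 0. \<forall>m. Y h i $ m = y $ m + h * (\<Sum>j\<in>{1..<i}. a i j * (\<Sum>\<nu>\<in>UNIV.
         p m \<nu> (Y h j) * (Y h i $ \<nu> / \<rho> i \<nu> y (Y h)) - d m \<nu> (Y h j) * (Y h i $ m / \<rho> i m y (Y h))))"
      using step by eventually_elim (use less.prems in \<open>simp add: mprk_step_def\<close>)
    then have "(\<lambda>h. Y h i $ m - y $ m) \<in> O[at_right 0](\<lambda>h. h)" for m
      by (rule patankar_stage_bigo[OF pds cont y _ _ IH, rotated -1,
            where R = "\<lambda>\<nu>. \<rho> i \<nu> y (\<lambda>_. y)" and m = m])
        (use less.prems in \<open>auto intro!: a patankar_weight_tendsto[OF \<rho>[OF i] y] IH
          patankar_weight_pos[OF \<rho>[OF i] y]\<close>)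
    then show ?case by (rule tendsto_vec_of_diff_bigo_id)
  qed
  have "\<forall>\<^sub>F h in at_right 0. \<forall>m. z h $ m = y $ m + h * (\<Sum>j\<in>{1..s}. b j * (\<Sum>\<nu>\<in>UNIV.
       p m \<nu> (Y h j) * (z h $ \<nu> / \<sigma> \<nu> y (Y h)) - d m \<nu> (Y h j) * (z h $ m / \<sigma> m y (Y h))))"
    using step by eventually_elim (simp add: mprk_step_def)
  then show "(\<lambda>h. z h $ m - y $ m) \<in> O[at_right 0](\<lambda>h. h)"
    by (rule patankar_stage_bigo[OF pds cont y _ _ Y, rotated -1,
          where R = "\<lambda>\<nu>. \<sigma> \<nu> y (\<lambda>_. y)"])
      (use Y in \<open>auto intro!: b patankar_weight_tendsto[OF \<sigma> y] patankar_weight_pos[OF \<sigma> y]\<close>)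
qed

section \<open>Expansion of the additive step and of the exact solution up to O(h^2)\<close>

text \<open>Explicitness permits strong induction: earlier stages tend to \<open>y\<close>, so by
  continuity the parts are bounded along them, and bounded coefficients leave an increment of size
  O(h).\<close>

lemma ark_stage_bigo:
  fixes V :: "real \<Rightarrow> nat \<Rightarrow> real^'n::finite"
  assumes G: "\<And>\<nu>. continuous_on pos_vecs (G \<nu>)" and y: "y \<in> pos_vecs"
    and \<alpha>: "\<And>i j \<nu>. i \<in> {1..s} \<Longrightarrow> j \<in> {1..<i} \<Longrightarrow> (\<lambda>h. \<alpha> h i j \<nu>) \<in> O[at_right 0](\<lambda>_. 1)"
    and step: "\<forall>\<^sub>F h in at_right 0. ark_step s (\<alpha> h) (\<beta> h) G h y (V h) (w h)"
    and "i \<in> {1..s}"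
  shows "(\<lambda>h. V h i $ m - y $ m) \<in> O[at_right 0](\<lambda>h. h)"
  using \<open>i \<in> {1..s}\<close>
proof (induction i arbitrary: m rule: less_induct)
  case (less i)
  have "(\<lambda>h. \<alpha> h i j \<nu> * G \<nu> (V h j) $ m) \<in> O[at_right 0](\<lambda>_. 1 * 1)" if j: "j \<in> {1..<i}" for j \<nu>
  proof (intro landau_o.big.mult \<alpha> less.prems j)
    have V: "((\<lambda>h. V h j) \<longlongrightarrow> y) (at_right 0)"
      by (rule tendsto_vec_of_diff_bigo_id, rule less.IH) (use j less.prems in auto)
    have "((\<lambda>h. G \<nu> (V h j)) \<longlongrightarrow> G \<nu> y) (at_right 0)"
      by (rule continuous_on_tendsto_compose[OF G V y eventually_in_pos_vecs[OF V y]])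
    then show "(\<lambda>h. G \<nu> (V h j) $ m) \<in> O[at_right 0](\<lambda>_. 1)"
      by (intro tendsto_imp_bigo_1[OF tendsto_vec_nth])
  qed
  then have "(\<lambda>h. \<Sum>j\<in>{1..<i}. \<Sum>\<nu>\<in>UNIV. \<alpha> h i j \<nu> * G \<nu> (V h j) $ m) \<in> O[at_right 0](\<lambda>_. 1)"
    by (intro big_sum_in_bigo) simp
  then have "(\<lambda>h. h * (\<Sum>j\<in>{1..<i}. \<Sum>\<nu>\<in>UNIV. \<alpha> h i j \<nu> * G \<nu> (V h j) $ m))
      \<in> O[at_right 0](\<lambda>h. h * 1)"
    by (intro landau_o.big.mult) auto
  then have "(\<lambda>h. h * (\<Sum>j\<in>{1..<i}. \<Sum>\<nu>\<in>UNIV. \<alpha> h i j \<nu> * G \<nu> (V h j) $ m)) \<in> O[at_right 0](\<lambda>h. h)"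
    by simp
  moreover have "\<forall>\<^sub>F h in at_right 0. V h i $ m - y $ m =
      h * (\<Sum>j\<in>{1..<i}. \<Sum>\<nu>\<in>UNIV. \<alpha> h i j \<nu> * G \<nu> (V h j) $ m)"
    using step
  proof eventually_elim
    case (elim h)
    then have "V h i = y + h *\<^sub>R (\<Sum>j\<in>{1..<i}. \<Sum>\<nu>\<in>UNIV. \<alpha> h i j \<nu> *\<^sub>R G \<nu> (V h j))"
      using less.prems by (simp add: ark_step_def)
    then show ?case by (simp add: sum_component)
  qed
  ultimately show ?case by (rule landau_o.big.in_cong[THEN iffD2, rotated])
qed

text \<open>Lipschitz continuity carries the O(h) deviation of the stages over to the parts, and the
  coefficients deviate from \<open>b\<close> by O(h) as well. The outer factor \<open>h\<close>
  turns this into O(h^2), and what remains is the Euler increment because the entries of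
  \<open>b\<close> sum to one.\<close>

lemma ark_step_expansion:
  fixes V :: "real \<Rightarrow> nat \<Rightarrow> real^'n::finite"
  assumes G: "\<And>\<nu>. \<exists>L. L-lipschitz_on pos_vecs (G \<nu>)" and y: "y \<in> pos_vecs"
    and \<alpha>: "\<And>i j \<nu>. i \<in> {1..s} \<Longrightarrow> j \<in> {1..<i} \<Longrightarrow> (\<lambda>h. \<alpha> h i j \<nu>) \<in> O[at_right 0](\<lambda>_. 1)"
    and \<beta>: "\<And>j \<nu>. j \<in> {1..s} \<Longrightarrow> (\<lambda>h. \<beta> h j \<nu> - b j) \<in> O[at_right 0](\<lambda>h. h)"
    and b: "(\<Sum>j\<in>{1..s}. b j) = 1"
    and step: "\<forall>\<^sub>F h in at_right 0. ark_step s (\<alpha> h) (\<beta> h) G h y (V h) (w h)"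
  shows "(\<lambda>h. norm (w h - y - h *\<^sub>R (\<Sum>\<nu>\<in>UNIV. G \<nu> y))) \<in> O[at_right 0](\<lambda>h. h\<^sup>2)"
  unfolding norm_vec_bigo_iff
proof
  fix m
  have cont: "continuous_on pos_vecs (G \<nu>)" for \<nu>
    using G lipschitz_on_continuous_on by blast
  have V: "(\<lambda>h. V h j $ m - y $ m) \<in> O[at_right 0](\<lambda>h. h)" if "j \<in> {1..s}" for j m
    by (rule ark_stage_bigo[OF cont y \<alpha> step that])
  have "(\<lambda>h. \<beta> h j \<nu> * G \<nu> (V h j) $ m - b j * G \<nu> y $ m) \<in> O[at_right 0](\<lambda>h. h)"
    if j: "j \<in> {1..s}" for j \<nu>
  proof -
    have Vlim: "((\<lambda>h. V h j) \<longlongrightarrow> y) (at_right 0)"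
      using V[OF j] by (rule tendsto_vec_of_diff_bigo_id)
    obtain L where L: "L-lipschitz_on pos_vecs (G \<nu>)" using G by blast
    have "(\<lambda>h. norm (G \<nu> (V h j) - G \<nu> y)) \<in> O[at_right 0](\<lambda>h. norm (V h j - y))"
      using eventually_in_pos_vecs[OF Vlim y]
      by (intro bigoI[of _ L], elim eventually_mono)
        (use lipschitz_onD[OF L _ y] in \<open>simp add: dist_norm\<close>)
    also have "(\<lambda>h. norm (V h j - y)) \<in> O[at_right 0](\<lambda>h. h)"
      using V[OF j] by (simp add: norm_vec_bigo_iff)
    finally have GV: "(\<lambda>h. G \<nu> (V h j) $ m - G \<nu> y $ m) \<in> O[at_right 0](\<lambda>h. h)"
      by (simp add: norm_vec_bigo_iff)
    have "((\<lambda>h. G \<nu> (V h j) $ m) \<longlongrightarrow> G \<nu> y $ m) (at_right 0)"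
      using GV by (rule tendsto_of_diff_bigo_id)
    then have "(\<lambda>h. (\<beta> h j \<nu> - b j) * G \<nu> (V h j) $ m) \<in> O[at_right 0](\<lambda>h. h * 1)"
      by (intro landau_o.big.mult \<beta> j tendsto_imp_bigo_1)
    \<comment> \<open>Splits the difference of products into the coefficient error times a bounded
      value plus \<open>b j\<close> times the error of the part.\<close>
    then have "(\<lambda>h. (\<beta> h j \<nu> - b j) * G \<nu> (V h j) $ m + b j * (G \<nu> (V h j) $ m - G \<nu> y $ m))
        \<in> O[at_right 0](\<lambda>h. h)"
      using GV by (intro sum_in_bigo) simp_all
    then show ?thesis by (simp add: algebra_simps)
  qed
  then have "(\<lambda>h. \<Sum>j\<in>{1..s}. \<Sum>\<nu>\<in>UNIV. \<beta> h j \<nu> * G \<nu> (V h j) $ m - b j * G \<nu> y $ m)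
      \<in> O[at_right 0](\<lambda>h. h)"
    by (intro big_sum_in_bigo)
  then have "(\<lambda>h. h * (\<Sum>j\<in>{1..s}. \<Sum>\<nu>\<in>UNIV. \<beta> h j \<nu> * G \<nu> (V h j) $ m - b j * G \<nu> y $ m))
      \<in> O[at_right 0](\<lambda>h. h * h)"
    by (intro landau_o.big.mult) auto
  moreover have "\<forall>\<^sub>F h in at_right 0. (w h - y - h *\<^sub>R (\<Sum>\<nu>\<in>UNIV. G \<nu> y)) $ m =
      h * (\<Sum>j\<in>{1..s}. \<Sum>\<nu>\<in>UNIV. \<beta> h j \<nu> * G \<nu> (V h j) $ m - b j * G \<nu> y $ m)"
    using step
  proof eventually_elim
    case (elim h)
    have "(\<Sum>j\<in>{1..s}. \<Sum>\<nu>\<in>UNIV. b j * G \<nu> y $ m) = (\<Sum>\<nu>\<in>UNIV. G \<nu> y $ m)"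
      by (simp add: sum_distrib_left[symmetric] sum_distrib_right[symmetric] b[simplified])
    moreover have "w h = y + h *\<^sub>R (\<Sum>j\<in>{1..s}. \<Sum>\<nu>\<in>UNIV. \<beta> h j \<nu> *\<^sub>R G \<nu> (V h j))"
      using elim by (simp add: ark_step_def)
    ultimately show ?case by (simp add: sum_component sum_subtractf right_diff_distrib)
  qed
  ultimately show "(\<lambda>h. (w h - y - h *\<^sub>R (\<Sum>\<nu>\<in>UNIV. G \<nu> y)) $ m) \<in> O[at_right 0](\<lambda>h. h\<^sup>2)"
    unfolding power2_eq_square by (rule landau_o.big.in_cong[THEN iffD2, rotated])
qed

text \<open>Replaces Taylor expansion, so that no second derivative of \<open>u\<close> is involved.
  The linearization inequality is applied twice: first with a bound on the derivative over the
  compact interval, to see that \<open>u\<close> moves by O(h), then with the Lipschitz bound on the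
  variation of the derivative.\<close>

lemma ivp_solution_expansion:
  fixes f :: "'a::real_normed_vector \<Rightarrow> 'a"
  assumes L: "L-lipschitz_on S f" and sol: "ivp_solution (\<lambda>t y. f y) S t0 y0 T u"
  shows "(\<lambda>h. norm (u (t0 + h) - y0 - h *\<^sub>R f y0)) \<in> O[at_right 0](\<lambda>h. h\<^sup>2)"
proof -
  have T: "0 < T" and u0: "u t0 = y0" and uS: "\<And>t. t \<in> {t0..t0 + T} \<Longrightarrow> u t \<in> S"
    and du: "\<And>t. t \<in> {t0..t0 + T} \<Longrightarrow>
      (u has_vector_derivative f (u t)) (at t within {t0..t0 + T})"
    using sol by (auto simp: ivp_solution_def)
  have y0: "y0 \<in> S" using uS[of t0] T u0 by simp
  have "continuous_on {t0..t0 + T} u"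
    by (rule continuous_on_vector_derivative[OF du])
  then have "continuous_on {t0..t0 + T} (\<lambda>t. f (u t))"
    by (rule continuous_on_compose2[OF lipschitz_on_continuous_on[OF L]]) (use uS in auto)
  then have "bounded ((\<lambda>t. f (u t)) ` {t0..t0 + T})"
    by (intro compact_imp_bounded compact_continuous_image) auto
  then obtain K where K: "\<And>t. t \<in> {t0..t0 + T} \<Longrightarrow> norm (f (u t)) \<le> K"
    unfolding bounded_iff by (metis imageI)
  have L0: "0 \<le> L" using L by (rule lipschitz_on_nonneg)
  have "\<forall>\<^sub>F h in at_right 0. h \<in> {0<..<T}"
    using T by (rule eventually_at_right_real)
  then have "\<forall>\<^sub>F h in at_right 0.
      norm (norm (u (t0 + h) - y0 - h *\<^sub>R f y0)) \<le> L * (3 * K) * norm (h\<^sup>2)"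
  proof eventually_elim
    case (elim h)
    define S' where "S' = {t0..t0 + h}"
    have S': "S' \<subseteq> {t0..t0 + T}" using elim by (auto simp: S'_def)
    have du': "(u has_vector_derivative f (u t)) (at t within S')" if "t \<in> S'" for t
      by (rule has_vector_derivative_within_subset[OF du S']) (use that S' in blast)
    have K': "norm (f (u x) - f (u t0)) \<le> 2 * K" if "x \<in> S'" for x
    proof -
      have "norm (f (u x)) \<le> K" "norm (f (u t0)) \<le> K"
        using K that S' T by auto
      then show ?thesis using norm_triangle_ineq4[of "f (u x)" "f (u t0)"] by linarith
    qed
    \<comment> \<open>The factor \<open>3 * K\<close> adds \<open>2 * K\<close> for the variation of
      the derivative and \<open>K\<close> for the linear term.\<close>
    have lin: "norm (u x - u t0) \<le> h * (3 * K)" if x: "x \<in> S'" for x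
    proof -
      have "norm (u x - u t0 - (x - t0) *\<^sub>R f (u t0)) \<le> norm (x - t0) * (2 * K)"
        by (rule vector_differentiable_bound_linearization[where S = S'])
          (use du' K' x elim in \<open>auto simp: S'_def closed_segment_eq_real_ivl\<close>)
      moreover have "norm ((x - t0) *\<^sub>R f (u t0)) \<le> norm (x - t0) * K"
        using K[of t0] T by (auto intro: mult_left_mono)
      ultimately have "norm (u x - u t0) \<le> norm (x - t0) * (2 * K) + norm (x - t0) * K"
        using norm_triangle_ineq[of "u x - u t0 - (x - t0) *\<^sub>R f (u t0)" "(x - t0) *\<^sub>R f (u t0)",
            unfolded diff_add_cancel]
        by linarith
      also have "\<dots> = norm (x - t0) * (3 * K)" by (simp add: algebra_simps)
      also have "\<dots> \<le> h * (3 * K)"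
        using x K[of t0] T order_trans[OF norm_ge_zero K[of t0]]
        by (intro mult_right_mono) (auto simp: S'_def)
      finally show ?thesis .
    qed
    have "norm (f (u x) - f (u t0)) \<le> L * (h * (3 * K))" if x: "x \<in> S'" for x
    proof -
      have "norm (f (u x) - f (u t0)) \<le> L * norm (u x - u t0)"
        using lipschitz_onD[OF L uS uS, of x t0] x S' T by (auto simp: dist_norm)
      also have "\<dots> \<le> L * (h * (3 * K))" by (intro mult_left_mono lin x L0)
      finally show ?thesis .
    qed
    \<comment> \<open>Second linearization: the derivative now varies by O(h) over an interval of
      length \<open>h\<close>.\<close>
    then have "norm (u (t0 + h) - u t0 - (t0 + h - t0) *\<^sub>R f (u t0)) \<le>
        norm (t0 + h - t0) * (L * (h * (3 * K)))"
      by (intro vector_differentiable_bound_linearization[where S = S'])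
        (use du' elim in \<open>auto simp: S'_def closed_segment_eq_real_ivl\<close>)
    then show ?case using elim by (simp add: u0 power2_eq_square algebra_simps)
  qed
  then show ?thesis by (rule bigoI)
qed

lemma lipschitz_on_sum:
  fixes f :: "'i \<Rightarrow> 'a::metric_space \<Rightarrow> 'b::real_normed_vector"
  assumes "finite I" "\<And>i. i \<in> I \<Longrightarrow> \<exists>L. L-lipschitz_on S (f i)"
  shows "\<exists>L. L-lipschitz_on S (\<lambda>x. \<Sum>i\<in>I. f i x)"
  using assms
proof (induction I rule: finite_induct)
  case empty
  then show ?case by (auto intro!: exI[of _ 0] lipschitz_onI)
next
  case (insert i I)
  then obtain L L' where "L-lipschitz_on S (f i)" "L'-lipschitz_on S (\<lambda>x. \<Sum>i\<in>I. f i x)"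
    by blast
  then have "(L + L')-lipschitz_on S (\<lambda>x. f i x + (\<Sum>i\<in>I. f i x))"
    by (rule lipschitz_on_add)
  with insert.hyps show ?case by auto
qed

section \<open>Test problems with constant right-hand sides\<close>

lemma Ck_on_const: "Ck_on k (\<lambda>_. v) S"
proof (induction k arbitrary: v)
  case (Suc k)
  then show ?case by (simp add: frechet_derivative_const)
qed simp

lemma bigo_cmult_id_square_iff:
  fixes f :: "real \<Rightarrow> real"
  shows "(\<lambda>h. h * f h) \<in> O[at_right 0](\<lambda>h. h\<^sup>2) \<longleftrightarrow> f \<in> O[at_right 0](\<lambda>h. h)"
  unfolding power2_eq_square
  by (rule landau_o.big.mult_cancel_left) (auto intro: eventually_mono[OF eventually_at_right_less[of 0]])

text \<open>Tested on the constant field of ones, started at zero: each component of the numerical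
  result is \<open>h * B\<close>, that of the solution is \<open>h\<close>, so
  \<open>h * (B - 1)\<close> has to be O(h^2).\<close>

lemma rk_order_ge_1_imp_weights_sum:
  assumes "rk_order_ge TYPE('n::finite) 1 s a b c"
  shows "(\<Sum>j\<in>{1..s}. b j) = 1"
proof -
  define B where "B = (\<Sum>j\<in>{1..s}. b j)"
  define v :: "real^'n" where "v = 1"
  have "(\<lambda>h::real. norm ((h * B) *\<^sub>R v - h *\<^sub>R v)) \<in> O[at_right 0](\<lambda>h. h ^ Suc 1)"
  proof -
    have ck: "Ck_on (Suc 1) (\<lambda>(t, y). (\<lambda>_ _. v) t y) (UNIV :: (real \<times> (real^'n)) set)"
      using Ck_on_const[of "Suc 1" v UNIV] by (simp add: case_prod_unfold)
    have sol: "ivp_solution (\<lambda>_ _. v) UNIV 0 0 1 (\<lambda>t. t *\<^sub>R v)"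
      by (auto simp: ivp_solution_def intro!: derivative_eq_intros)
    have step: "\<forall>\<^sub>F h in at_right 0. rk_step s a b c (\<lambda>_ _. v) 0 h 0
        (\<lambda>i. 0 + h *\<^sub>R (\<Sum>j\<in>{1..s}. a i j *\<^sub>R v)) ((h * B) *\<^sub>R v)"
      by (intro always_eventually) (simp add: rk_step_def B_def scaleR_sum_left[symmetric])
    show ?thesis
      using assms[unfolded rk_order_ge_def, rule_format, OF ck sol step] by simp
  qed
  then have "(\<lambda>h. ((h * B) *\<^sub>R v - h *\<^sub>R v) $ undefined) \<in> O[at_right 0](\<lambda>h. h\<^sup>2)"
    unfolding norm_vec_bigo_iff by (simp add: numeral_2_eq_2)
  then have "(\<lambda>h. h * (B - 1)) \<in> O[at_right 0](\<lambda>h. h\<^sup>2)"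
    by (simp add: v_def algebra_simps)
  then have "(\<lambda>h. B - 1) \<in> O[at_right 0](\<lambda>h. h)"
    by (simp only: bigo_cmult_id_square_iff)
  \<comment> \<open>The constant function \<open>B\<close> tends to 1 as h tends to zero, so
    \<open>B\<close> equals 1.\<close>
  then have "((\<lambda>h::real. B) \<longlongrightarrow> 1) (at_right 0)"
    by (rule tendsto_of_diff_bigo_id)
  then show ?thesis unfolding B_def
    by (simp add: tendsto_const_iff)
qed

text \<open>Only the part with index \<open>\<mu>\<close> is nonzero, so the local error isolates the single weight \<open>z $ \<mu> / \<sigma> \<mu>\<close>.\<close>
definition unit_flow :: "'n \<Rightarrow> 'n \<Rightarrow> 'n \<Rightarrow> 'n \<Rightarrow> 'a \<Rightarrow> real" where
  "unit_flow \<kappa> \<mu> m \<nu> y = (if m = \<kappa> \<and> \<nu> = \<mu> then 1 else 0)"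

lemma F_part_unit_flow:
  assumes "\<kappa> \<noteq> \<mu>"
  shows "F_part (unit_flow \<kappa> \<mu>) (unit_flow \<mu> \<kappa>) \<nu> y =
    (if \<nu> = \<mu> then axis \<kappa> 1 - axis \<mu> 1 else (0 :: real^'n::finite))"
  using assms by (auto simp: F_part_def unit_flow_def vec_eq_iff axis_def)

text \<open>Swapping the first two arguments of \<open>unit_flow\<close> transposes the rates, as
  the balance of production and destruction demands. The parts are constant, hence smooth to every
  order with Lipschitz constant zero.\<close>

lemma pds_class_unit_flow:
  assumes "\<kappa> \<noteq> \<mu>"
  shows "pds_class k (unit_flow \<kappa> \<mu>) (unit_flow \<mu> (\<kappa> :: 'n::finite))"
proof -
  have "F_part (unit_flow \<kappa> \<mu>) (unit_flow \<mu> \<kappa>) \<nu> =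
      (\<lambda>_. if \<nu> = \<mu> then axis \<kappa> 1 - axis \<mu> 1 else (0 :: real^'n))" for \<nu>
    by (rule ext) (rule F_part_unit_flow[OF assms])
  then show ?thesis
    using assms
    by (auto simp: pds_class_def pds_def unit_flow_def Ck_on_const
        intro!: exI[of _ 0] lipschitz_onI)
qed

lemma ivp_solution_const:
  fixes y v :: "real^'n::finite"
  assumes "y \<in> pos_vecs"
  shows "\<exists>T. ivp_solution (\<lambda>_ _. v) pos_vecs 0 y T (\<lambda>t. y + t *\<^sub>R v)"
proof -
  have "((\<lambda>t. y + t *\<^sub>R v) \<longlongrightarrow> y + 0 *\<^sub>R v) (at_right 0)"
    by (intro tendsto_intros)
  then have "\<forall>\<^sub>F t in at_right 0. y + t *\<^sub>R v \<in> pos_vecs"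
    using assms by (intro eventually_in_pos_vecs) auto
  then obtain T where T: "0 < T" "\<And>t. 0 < t \<Longrightarrow> t < T \<Longrightarrow> y + t *\<^sub>R v \<in> pos_vecs"
    by (auto simp: eventually_at_right_field)
  \<comment> \<open>Positivity is known on an open interval ending at \<open>T\<close>, whereas a
    solution has to live on a closed one; hence \<open>T / 2\<close>.\<close>
  have "y + t *\<^sub>R v \<in> pos_vecs" if "t \<in> {0..T / 2}" for t
    using T that assms by (cases "t = 0") auto
  then have "ivp_solution (\<lambda>_ _. v) pos_vecs 0 y (T / 2) (\<lambda>t. y + t *\<^sub>R v)"
    using T(1) by (auto simp: ivp_solution_def intro!: derivative_eq_intros)
  then show ?thesis by blast
qed

text \<open>The step for \<open>p\<close> and \<open>d\<close> supplies the coefficients, but the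
  error is measured on the unit flow. This is legitimate because \<open>mprk_order_ge\<close>
  demands the error bound for every system of the class with these coefficients.\<close>

lemma mprk_order_ge_1_imp_weight_ratio:
  fixes Y :: "real \<Rightarrow> nat \<Rightarrow> real^'n::finite"
  assumes order: "mprk_order_ge 1 s a b \<rho> \<sigma> p d" and card: "2 \<le> CARD('n)"
    and b: "(\<Sum>j\<in>{1..s}. b j) = 1" and y: "y \<in> pos_vecs"
    and step: "\<forall>\<^sub>F h in at_right 0. mprk_step s a b \<rho> \<sigma> p d h y (Y h) (z h)"
  shows "(\<lambda>h. z h $ \<mu> / \<sigma> \<mu> y (Y h) - 1) \<in> O[at_right 0](\<lambda>h. h)"
proof -
  \<comment> \<open>The receiving component exists because there are at least two
    components.\<close>
  obtain \<kappa> where \<kappa>: "\<kappa> \<noteq> \<mu>"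
    using card card_mono[of "{\<mu>}" "UNIV :: 'n set"] by auto
  define G where "G = F_part (unit_flow \<kappa> \<mu>) (unit_flow \<mu> \<kappa>)"
  define v where "v = axis \<kappa> 1 - axis \<mu> (1::real)"
  have G: "G \<nu> x = (if \<nu> = \<mu> then v else 0)" for \<nu> x
    unfolding G_def v_def by (rule F_part_unit_flow[OF \<kappa>])
  obtain T where sol: "ivp_solution (\<lambda>_ _. v) pos_vecs 0 y T (\<lambda>t. y + t *\<^sub>R v)"
    using ivp_solution_const[OF y] by blast
  then have sol': "ivp_solution (\<lambda>t x. \<Sum>\<nu>\<in>UNIV. G \<nu> x) pos_vecs 0 y T (\<lambda>t. y + t *\<^sub>R v)"
    by (simp add: G)
  define \<alpha> where "\<alpha> = (\<lambda>h i j \<nu>. a i j * (Y h i $ \<nu> / \<rho> i \<nu> y (Y h)))"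
  define \<beta> where "\<beta> = (\<lambda>h j \<nu>. b j * (z h $ \<nu> / \<sigma> \<nu> y (Y h)))"
  \<comment> \<open>The parts do not depend on the state, so the stage values drop out and every
    part may be evaluated at \<open>y\<close>.\<close>
  define w where "w = (\<lambda>h. y + h *\<^sub>R (\<Sum>j\<in>{1..s}. \<Sum>\<nu>\<in>UNIV. \<beta> h j \<nu> *\<^sub>R G \<nu> y))"
  have "ark_step s (\<alpha> h) (\<beta> h) G h y
      (\<lambda>i. y + h *\<^sub>R (\<Sum>j\<in>{1..<i}. \<Sum>\<nu>\<in>UNIV. \<alpha> h i j \<nu> *\<^sub>R G \<nu> y)) (w h)" for h
    unfolding ark_step_def w_def G by simp
  then have "(\<lambda>h. norm (w h - (y + (0 + h) *\<^sub>R v))) \<in> O[at_right 0](\<lambda>h. h ^ Suc 1)"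
    unfolding \<alpha>_def \<beta>_def G_def
    by (intro order[unfolded mprk_order_ge_def, rule_format, OF y step pds_class_unit_flow[OF \<kappa>]
        sol'[unfolded G_def]] always_eventually allI)
  then have "(\<lambda>h. (w h - (y + h *\<^sub>R v)) $ \<kappa>) \<in> O[at_right 0](\<lambda>h. h\<^sup>2)"
    unfolding norm_vec_bigo_iff by (simp add: numeral_2_eq_2)
  moreover have "(w h - (y + h *\<^sub>R v)) $ \<kappa> = h * (z h $ \<mu> / \<sigma> \<mu> y (Y h) - 1)" for h
  proof -
    have "(\<Sum>\<nu>\<in>UNIV. \<beta> h j \<nu> *\<^sub>R G \<nu> y) = b j *\<^sub>R (z h $ \<mu> / \<sigma> \<mu> y (Y h)) *\<^sub>R v" for j
    proof -
      have "(\<Sum>\<nu>\<in>UNIV. \<beta> h j \<nu> *\<^sub>R G \<nu> y) = (\<Sum>\<nu>\<in>UNIV. if \<nu> = \<mu> then \<beta> h j \<mu> *\<^sub>R v else 0)"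
        by (intro sum.cong) (auto simp: G)
      then show ?thesis by (simp add: \<beta>_def)
    qed
    then have "w h = y + h *\<^sub>R (z h $ \<mu> / \<sigma> \<mu> y (Y h)) *\<^sub>R v"
      by (simp add: w_def scaleR_sum_left[symmetric] b[simplified] del: scaleR_scaleR)
    then have "w h $ \<kappa> = y $ \<kappa> + h * (z h $ \<mu> / \<sigma> \<mu> y (Y h)) * v $ \<kappa>" by simp
    moreover have "v $ \<kappa> = 1" using \<kappa> by (simp add: v_def axis_def)
    ultimately show ?thesis by (simp add: right_diff_distrib)
  qed
  ultimately show ?thesis by (simp only: bigo_cmult_id_square_iff)
qed

text \<open>At least two components are required: with a single one the diagonal condition makes
  every part zero, so order one would hold for any admissible \<open>\<sigma>\<close>.\<close>

theorem theorem17: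
  fixes s :: nat
    and a :: "nat \<Rightarrow> nat \<Rightarrow> real" and b c :: "nat \<Rightarrow> real"
    and \<rho> :: "nat \<Rightarrow> 'n::finite \<Rightarrow> real^'n \<Rightarrow> (nat \<Rightarrow> real^'n) \<Rightarrow> real"
    and \<sigma> :: "'n \<Rightarrow> real^'n \<Rightarrow> (nat \<Rightarrow> real^'n) \<Rightarrow> real"
    and p d :: "'n \<Rightarrow> 'n \<Rightarrow> real^'n \<Rightarrow> real"
  assumes "2 \<le> CARD('n)"
    and "pds p d"
    and "\<And>\<nu>. Ck_on 2 (F_part p d \<nu>) pos_vecs"
    and "\<And>\<nu>. \<exists>L. L-lipschitz_on pos_vecs (F_part p d \<nu>)"
    and "\<And>i j. i \<in> {1..s} \<Longrightarrow> j \<in> {1..s} \<Longrightarrow> 0 \<le> a i j"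
    and "\<And>j. j \<in> {1..s} \<Longrightarrow> 0 \<le> b j"
    and "\<And>i j. i \<in> {1..s} \<Longrightarrow> j \<in> {1..s} \<Longrightarrow> i \<le> j \<Longrightarrow> a i j = 0"
    and "\<And>i. i \<in> {1..s} \<Longrightarrow> c i = (\<Sum>j\<in>{1..s}. a i j)"
    and "rk_order_ge TYPE('n) 1 s a b c"
    and "\<And>i \<nu>. i \<in> {2..s} \<Longrightarrow> patankar_weight (i - 1) (\<rho> i \<nu>)"
    and "\<And>\<nu>. patankar_weight s (\<sigma> \<nu>)"
  shows "mprk_order_ge 1 s a b \<rho> \<sigma> p d \<longleftrightarrow>
    (\<forall>y\<^sub>n\<in>pos_vecs. \<forall>Y z.
       (\<forall>\<^sub>F h in at_right 0. mprk_step s a b \<rho> \<sigma> p d h y\<^sub>n (Y h) (z h)) \<longrightarrow>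
       (\<forall>\<mu>. (\<lambda>h. \<sigma> \<mu> y\<^sub>n (Y h) - y\<^sub>n $ \<mu>) \<in> O[at_right 0](\<lambda>h. h)))"
proof -
  note pds = assms(2)
  have cont: "continuous_on pos_vecs (F_part p d \<nu>)" for \<nu>
    using F_part_continuous_on[of 1 p d \<nu>] assms(3)[of \<nu>] by (simp only: Suc_1)
  have b: "(\<Sum>j\<in>{1..s}. b j) = 1"
    using assms(9) by (rule rk_order_ge_1_imp_weights_sum)
  note stage = mprk_stage_tendsto[OF pds cont assms(5,6,10,11)]
    and result = mprk_result_bigo[OF pds cont assms(5,6,10,11)]
  \<comment> \<open>Common core of both directions: \<open>z\<close> is within O(h) of
    \<open>y\<close> and the denominators have a positive limit, so the condition on
    \<open>\<sigma>\<close> and the condition on the weight ratio are interchangeable.\<close>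
  have ratio: "(\<lambda>h. z h $ \<mu> / \<sigma> \<mu> y (Y h) - 1) \<in> O[at_right 0](\<lambda>h. h) \<longleftrightarrow>
      (\<lambda>h. \<sigma> \<mu> y (Y h) - y $ \<mu>) \<in> O[at_right 0](\<lambda>h. h)"
    if y: "y \<in> pos_vecs"
      and step: "\<forall>\<^sub>F h in at_right 0. mprk_step s a b \<rho> \<sigma> p d h y (Y h) (z h)" for y Y z \<mu>
  proof (rule ratio_diff_one_bigo_iff)
    show "(\<lambda>h. z h $ \<mu> - y $ \<mu>) \<in> O[at_right 0](\<lambda>h. h)"
      by (rule result[OF _ _ _ _ y step])
    show "((\<lambda>h. \<sigma> \<mu> y (Y h)) \<longlongrightarrow> \<sigma> \<mu> y (\<lambda>_. y)) (at_right 0)"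
      by (rule patankar_weight_tendsto[OF assms(11) y stage[OF _ _ _ _ y step]])
    show "\<sigma> \<mu> y (\<lambda>_. y) \<noteq> 0"
      using patankar_weight_pos[OF assms(11)[of \<mu>] y] by simp
  qed
  show ?thesis
  proof (intro iffI ballI allI impI)
    fix y Y z \<mu>
    assume "mprk_order_ge 1 s a b \<rho> \<sigma> p d" "y \<in> pos_vecs"
      "\<forall>\<^sub>F h in at_right 0. mprk_step s a b \<rho> \<sigma> p d h y (Y h) (z h)"
    then show "(\<lambda>h. \<sigma> \<mu> y (Y h) - y $ \<mu>) \<in> O[at_right 0](\<lambda>h. h)"
      using ratio[of y Y z \<mu>] mprk_order_ge_1_imp_weight_ratio[OF _ assms(1) b, of a \<rho> \<sigma> p d y Y z \<mu>]
      by simp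
  next
    assume \<sigma>: "\<forall>y\<in>pos_vecs. \<forall>Y z.
       (\<forall>\<^sub>F h in at_right 0. mprk_step s a b \<rho> \<sigma> p d h y (Y h) (z h)) \<longrightarrow>
       (\<forall>\<mu>. (\<lambda>h. \<sigma> \<mu> y (Y h) - y $ \<mu>) \<in> O[at_right 0](\<lambda>h. h))"
    show "mprk_order_ge 1 s a b \<rho> \<sigma> p d"
      unfolding mprk_order_ge_def
    proof (intro ballI allI impI)
      fix y Y z q e t T u V w
      assume y: "y \<in> pos_vecs"
        and step: "\<forall>\<^sub>F h in at_right 0. mprk_step s a b \<rho> \<sigma> p d h y (Y h) (z h)"
        and qe: "pds_class (Suc 1) q e"
        and sol: "ivp_solution (\<lambda>t y. \<Sum>\<nu>\<in>UNIV. F_part q e \<nu> y) pos_vecs t y T u"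
        and ark: "\<forall>\<^sub>F h in at_right 0.
              ark_step s (\<lambda>i j \<nu>. a i j * (Y h i $ \<nu> / \<rho> i \<nu> y (Y h)))
                (\<lambda>j \<nu>. b j * (z h $ \<nu> / \<sigma> \<nu> y (Y h))) (F_part q e) h y (V h) (w h)"
      define G where "G = F_part q e"
      have lip: "\<exists>L. L-lipschitz_on pos_vecs (G \<nu>)" for \<nu>
        using qe by (simp add: pds_class_def G_def)
      have Ylim: "((\<lambda>h. Y h i) \<longlongrightarrow> y) (at_right 0)" if "i \<in> {1..s}" for i
        by (rule stage[OF _ _ _ _ y step that])
      \<comment> \<open>For the stage coefficients boundedness is enough at this order: they
        influence the result only through the stages, which are then still within O(h) of
        \<open>y\<close>.\<close>
      have \<alpha>: "(\<lambda>h. a i j * (Y h i $ \<nu> / \<rho> i \<nu> y (Y h))) \<in> O[at_right 0](\<lambda>_. 1)"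
        if "i \<in> {1..s}" "j \<in> {1..<i}" for i j \<nu>
      proof (rule tendsto_imp_bigo_1)
        have weight: "patankar_weight (i - 1) (\<rho> i \<nu>)"
          using that by (intro assms(10)) auto
        have "((\<lambda>h. \<rho> i \<nu> y (Y h)) \<longlongrightarrow> \<rho> i \<nu> y (\<lambda>_. y)) (at_right 0)"
          using that by (intro patankar_weight_tendsto[OF weight y] Ylim) auto
        then show "((\<lambda>h. a i j * (Y h i $ \<nu> / \<rho> i \<nu> y (Y h))) \<longlongrightarrow>
            a i j * (y $ \<nu> / \<rho> i \<nu> y (\<lambda>_. y))) (at_right 0)"
          using patankar_weight_pos[OF weight y]
          by (intro tendsto_mult tendsto_const tendsto_divide tendsto_vec_nth Ylim that) auto
      qed
      have \<beta>: "(\<lambda>h. b j * (z h $ \<nu> / \<sigma> \<nu> y (Y h)) - b j) \<in> O[at_right 0](\<lambda>h. h)" for j \<nu>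
      proof -
        have "(\<lambda>h. z h $ \<nu> / \<sigma> \<nu> y (Y h) - 1) \<in> O[at_right 0](\<lambda>h. h)"
          using ratio[OF y step] \<sigma> y step by blast
        then have "(\<lambda>h. b j * (z h $ \<nu> / \<sigma> \<nu> y (Y h) - 1)) \<in> O[at_right 0](\<lambda>h. h)"
          by simp
        then show ?thesis by (simp add: right_diff_distrib)
      qed
      have w: "(\<lambda>h. norm (w h - y - h *\<^sub>R (\<Sum>\<nu>\<in>UNIV. G \<nu> y))) \<in> O[at_right 0](\<lambda>h. h\<^sup>2)"
        by (rule ark_step_expansion[OF lip y \<alpha> \<beta> b ark[folded G_def]])
      obtain L where "L-lipschitz_on pos_vecs (\<lambda>y. \<Sum>\<nu>\<in>UNIV. G \<nu> y)"
        using lipschitz_on_sum[of UNIV pos_vecs G] lip by auto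
      then have u: "(\<lambda>h. norm (u (t + h) - y - h *\<^sub>R (\<Sum>\<nu>\<in>UNIV. G \<nu> y))) \<in> O[at_right 0](\<lambda>h. h\<^sup>2)"
        using sol unfolding G_def by (rule ivp_solution_expansion)
      \<comment> \<open>The numerical and the exact result share the same Euler predictor, which
        cancels in the difference of the two remainders.\<close>
      have "(\<lambda>h. (w h - y - h *\<^sub>R (\<Sum>\<nu>\<in>UNIV. G \<nu> y)) $ m -
          (u (t + h) - y - h *\<^sub>R (\<Sum>\<nu>\<in>UNIV. G \<nu> y)) $ m) \<in> O[at_right 0](\<lambda>h. h\<^sup>2)" for m
        using w u unfolding norm_vec_bigo_iff by (intro sum_in_bigo) auto
      then show "(\<lambda>h. norm (w h - u (t + h))) \<in> O[at_right 0](\<lambda>h. h ^ Suc 1)"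
        by (simp add: norm_vec_bigo_iff numeral_2_eq_2)
    qed
  qed
qed

end
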